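(* For $t\ge1$ let $f_1(t)=252t+223$, $f_2(t)=6t+5$, $f_3(t)=7t+6$, $f_4(t)=36t+31$, and put $n_t=f_1(t)f_2(t)$, $N_t=n_t+1$. Let $$\mathcal T=\{t\in\mathbb N: f_1(t),f_2(t),f_3(t),f_4(t)\text{ are all prime}\},\qquad F(x)=\#\{t\in\mathcal T:n_t\le x\}.$$ (i) Assume Schinzel's Hypothesis $H$. Then $\mathcal T$ is infinite, and for every $t\in\mathcal T$, $\sigma(N_t)=2\sigma(n_t)$. Moreover, the integers $n_t$, $t\in\mathcal T$, are pairwise distinct. Consequently, under Schinzel's Hypothesis $H$, the equation $\sigma(n+1)=2\sigma(n)$ has infinitely many positive integer solutions. (ii) Assume the Bateman--Horn conjecture for the four linear forms $f_1,f_2,f_3,f_4$. For each prime $p$, let $\nu(p)$ denote the number of residue classes modulo $p$ on which $f_1(t)f_2(t)f_3(t)f_4(t)$ vanishes, and put $$\mathfrak S=\prod_p\left(1-\frac1p\right)^{-4}\left(1-\frac{\nu(p)}p\right).$$ Then $\mathfrak S>0$, and $$F(x)\sim\frac{8\mathfrak S}{3\sqrt{42}}\frac{\sqrt x}{(\log x)^4}\qquad(x\to\infty).$$ In particular, $F(x)\gg\dfrac{\sqrt x}{(\log x)^4}$.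
   Context: $\mathbb N=\{1,2,\ldots\}$; $\sigma(n)=\sum_{d\mid n}d$. Schinzel's Hypothesis $H$: if $g_1,\ldots,g_k\in\mathbb Z[t]$ are nonconstant irreducible polynomials with positive leading coefficients such that no prime divides $g_1(t)\cdots g_k(t)$ for every integer $t$, then there are infinitely many positive integers $t$ for which $g_1(t),\ldots,g_k(t)$ are all prime. Bateman--Horn conjecture for $f_1,\ldots,f_4$: as $T\to\infty$, $\#\{1\le t\le T: f_1(t),\ldots,f_4(t)\text{ all prime}\}\sim\mathfrak S\int_2^T\frac{du}{(\log u)^4}$, where $\mathfrak S$ is the product over primes displayed in the claim. $F(x)\gg G(x)$ means that $F(x)\ge c\,G(x)$ for some constant $c>0$ and all sufficiently large $x$. *)

theory Defs
  imports
    "HOL-Analysis.Analysis"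
    "HOL-Computational_Algebra.Computational_Algebra"
    "HOL-Library.Landau_Symbols"
begin

definition divisor_sum :: "nat \<Rightarrow> nat" where
  "divisor_sum n = (\<Sum>d | d dvd n. d)"

text \<open>Irreducibility is taken in the ring \<open>int poly\<close>; primality on \<^typ>\<open>int\<close> includes positivity.
  The family of polynomials is given as a nonempty list, so repetitions are allowed.\<close>

definition schinzel_H :: bool where
  "schinzel_H \<longleftrightarrow>
    (\<forall>gs :: int poly list.
       gs \<noteq> [] \<and>
       (\<forall>g\<in>set gs. degree g > 0 \<and> irreducible g \<and> lead_coeff g > 0) \<and>
       \<not> (\<exists>p::int. prime p \<and> (\<forall>t::int. p dvd (\<Prod>g\<leftarrow>gs. poly g t)))
       \<longrightarrow> infinite {t::nat. t \<ge> 1 \<and> (\<forall>g\<in>set gs. prime (poly g (int t)))})"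

definition f1 :: "nat \<Rightarrow> nat" where "f1 t = 252 * t + 223"
definition f2 :: "nat \<Rightarrow> nat" where "f2 t = 6 * t + 5"
definition f3 :: "nat \<Rightarrow> nat" where "f3 t = 7 * t + 6"
definition f4 :: "nat \<Rightarrow> nat" where "f4 t = 36 * t + 31"

definition n_of :: "nat \<Rightarrow> nat" where "n_of t = f1 t * f2 t"
definition N_of :: "nat \<Rightarrow> nat" where "N_of t = n_of t + 1"

definition T_set :: "nat set" where
  "T_set = {t. t \<ge> 1 \<and> prime (f1 t) \<and> prime (f2 t) \<and> prime (f3 t) \<and> prime (f4 t)}"

definition F_count :: "real \<Rightarrow> nat" where
  "F_count x = card {t \<in> T_set. real (n_of t) \<le> x}"

definition root_count :: "nat \<Rightarrow> nat" where
  "root_count p = card {r \<in> {0..<p}. p dvd f1 r * f2 r * f3 r * f4 r}"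

definition singular_factor :: "nat \<Rightarrow> real" where
  "singular_factor p = inverse ((1 - 1 / real p) ^ 4) * (1 - real (root_count p) / real p)"

text \<open>The product over all primes is an infinite product over \<^typ>\<open>nat\<close> whose factors at
  non-primes are 1. \<^const>\<open>prodinf\<close> is meaningful only for convergent products.\<close>

definition euler_factor :: "nat \<Rightarrow> real" where
  "euler_factor n = (if prime n then singular_factor n else 1)"

definition singular_series :: real where
  "singular_series = prodinf euler_factor"

definition bateman_horn_f1_f2_f3_f4 :: bool where
  "bateman_horn_f1_f2_f3_f4 \<longleftrightarrow>
    (\<lambda>T::real. real (card {t \<in> T_set. real t \<le> T}))
      \<sim>[at_top] (\<lambda>T. singular_series * integral {2..T} (\<lambda>u. 1 / (ln u) ^ 4))"

end

theory Submission
  imports Defs "HOL-Number_Theory.Cong" "HOL-Real_Asymp.Real_Asymp"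
begin

text \<open>
  Everything rests on the identity \<open>f\<^sub>1 f\<^sub>2 + 1 = 6 f\<^sub>3 f\<^sub>4\<close>: when the four values are prime, both
  divisor sums factor, and the linear forms are chosen so that the factors match up to \<open>2\<close>.
  The four forms have no fixed prime divisor, because the values of their product at \<open>0, 1, 3\<close> are
  jointly coprime. Hence Hypothesis \<open>H\<close> applies and no Euler factor vanishes; for \<open>p > 13\<close> the
  four roots modulo \<open>p\<close> are distinct and the Euler factor is \<open>1 + O(1/p\<^sup>2)\<close>, so the singular series
  converges to a positive number. Finally \<open>n\<^sub>t \<le> x\<close> means \<open>t \<le> \<tau>(x)\<close> for the positive
  root \<open>\<tau>(x) \<sim> sqrt (x / 1512)\<close> of a quadratic, and the asymptotics of \<open>F\<close> follow by substituting
  \<open>\<tau>(x)\<close> into \<open>\<integral>\<^sub>2\<^sup>T du / (ln u)\<^sup>4 \<sim> T / (ln T)\<^sup>4\<close>.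
\<close>

lemmas f_defs = f1_def f2_def f3_def f4_def

section \<open>Divisor sums\<close>

lemma divisor_sum_1 [simp]: "divisor_sum 1 = 1"
  by (simp add: divisor_sum_def)

text \<open>Divisors of \<open>p * n\<close> prime to \<open>p\<close> are those of
  \<open>n\<close>; the others are \<open>p\<close> times a divisor of \<open>n\<close>, as
  \<open>p\<close> does not divide \<open>n\<close>.\<close>

lemma divisor_sum_prime_mult:
  assumes p: "prime p" and n: "n > 0" "\<not> p dvd n"
  shows "divisor_sum (p * n) = (p + 1) * divisor_sum n"
proof -
  let ?D = "{d. d dvd n}"
  have p0: "p > 0"
    using p by (simp add: prime_gt_0_nat)
  have "d dvd n \<or> (\<exists>e. e dvd n \<and> d = p * e)" if "d dvd p * n" for d
  proof (cases "p dvd d")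
    case True
    then obtain e where "d = p * e" ..
    with that p0 show ?thesis by auto
  next
    case False
    then have "coprime d p"
      using prime_imp_coprime[OF p] by (simp add: coprime_commute)
    with that show ?thesis
      by (simp add: coprime_dvd_mult_right_iff)
  qed
  then have split: "{d. d dvd p * n} = ?D \<union> (\<lambda>e. p * e) ` ?D"
    by auto
  have "?D \<inter> (\<lambda>e. p * e) ` ?D = {}"
    using n(2) by (auto dest: dvd_mult_left)
  moreover have "finite ?D"
    using n(1) by simp
  moreover have "inj_on (\<lambda>e. p * e) ?D"
    using p0 by (auto intro: inj_onI)
  ultimately have "divisor_sum (p * n) = \<Sum>?D + (\<Sum>e\<in>?D. p * e)"
    unfolding divisor_sum_def split by (subst sum.union_disjoint) (auto simp: sum.reindex)
  then show ?thesis
    by (simp add: divisor_sum_def sum_distrib_left sum.distrib)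
qed

lemma divisor_sum_prime: "prime p \<Longrightarrow> divisor_sum p = p + 1"
  using divisor_sum_prime_mult[of p 1] by (auto simp del: One_nat_def)

lemma N_of_eq: "N_of t = 2 * (3 * (f3 t * f4 t))"
  by (simp add: N_of_def n_of_def f_defs algebra_simps)

text \<open>Here \<open>f1 t + 1 = 28 * (9 * t + 8)\<close> and
  \<open>f2 t + 1 = 6 * (t + 1)\<close>.\<close>

lemma divisor_sum_n_of:
  assumes "prime (f1 t)" "prime (f2 t)"
  shows "divisor_sum (n_of t) = 168 * ((t + 1) * (9 * t + 8))"
proof -
  have "\<not> f1 t dvd f2 t"
    by (auto simp: f_defs dest!: dvd_imp_le)
  with assms have "divisor_sum (n_of t) = (f1 t + 1) * (f2 t + 1)"
    by (simp add: n_of_def divisor_sum_prime_mult divisor_sum_prime prime_gt_0_nat)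
  then show ?thesis
    by (simp add: f_defs algebra_simps)
qed

text \<open>The primes 2 and 3 contribute 3 and 4, while \<open>f3 t + 1 = 7 * (t + 1)\<close> and
  \<open>f4 t + 1 = 4 * (9 * t + 8)\<close>: the same two factors as for \<open>n_of t\<close>, with
  twice the constant.\<close>

lemma divisor_sum_N_of:
  assumes t: "t \<ge> 1" and p: "prime (f3 t)" "prime (f4 t)"
  shows "divisor_sum (N_of t) = 336 * ((t + 1) * (9 * t + 8))"
proof -
  have not_dvd: "\<not> p dvd q" if "prime p" "prime q" "p \<noteq> q" for p q :: nat
    using that primes_dvd_imp_eq by blast
  have ne: "f4 t \<noteq> f3 t" "2 \<noteq> f3 t" "2 \<noteq> f4 t" "3 \<noteq> f3 t" "3 \<noteq> f4 t"
    using t by (auto simp: f_defs)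
  have "\<not> f3 t dvd f4 t"
    using p ne(1) not_dvd by metis
  moreover have "\<not> 3 dvd f3 t * f4 t" "\<not> 2 dvd 3 * (f3 t * f4 t)"
    using p ne by (simp_all add: prime_dvd_mult_iff not_dvd)
  moreover have "f3 t > 0" "f4 t > 0"
    by (simp_all add: f_defs)
  moreover have prime_3: "prime (3 :: nat)"
    by simp
  ultimately have "divisor_sum (N_of t) = 3 * (4 * ((f3 t + 1) * (f4 t + 1)))"
    unfolding N_of_eq using p
    by (simp only: divisor_sum_prime_mult divisor_sum_prime two_is_prime_nat prime_3
        mult_pos_pos zero_less_numeral not_False_eq_True) simp
  then show ?thesis
    by (simp add: f_defs algebra_simps)
qed

lemma strict_mono_n_of: "strict_mono n_of"
  by (intro strict_monoI) (auto simp: n_of_def f_defs intro!: mult_strict_mono)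

section \<open>Local solubility\<close>

lemma no_fixed_prime_divisor:
  fixes p :: nat
  assumes "prime p"
  obtains t where "\<not> p dvd f1 t * f2 t * f3 t * f4 t"
proof (rule ccontr)
  assume "\<not> thesis"
  with that have all: "p dvd f1 t * f2 t * f3 t * f4 t" for t
    by blast
  \<comment> \<open>The values at 0 and 1 share only the prime 5, which does not divide the value at
    3.\<close>
  have "p dvd gcd 207390 (gcd 4550975 84506301)"
    using all[of 0] all[of 1] all[of 3] by (simp add: f_defs)
  moreover have "gcd 207390 (gcd 4550975 84506301) = (1 :: nat)"
    by (simp add: gcd_non_0_nat)
  ultimately show False
    using assms by simp
qed

lemma root_count_less:
  assumes "prime p"
  shows "root_count p < p"
proof -
  obtain t where t: "\<not> p dvd f1 t * f2 t * f3 t * f4 t"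
    using no_fixed_prime_divisor[OF assms] .
  have cong: "p dvd f (t mod p) \<longleftrightarrow> p dvd f t"
    if "f = (\<lambda>t. a * t + b)" for f :: "nat \<Rightarrow> nat" and a b
    unfolding that dvd_eq_mod_eq_0 by (metis mod_add_left_eq mod_mult_right_eq)
  have "\<not> p dvd f1 (t mod p) * f2 (t mod p) * f3 (t mod p) * f4 (t mod p)"
    using t assms
    by (simp add: prime_dvd_mult_iff cong[of f1, OF ext[OF f1_def]] cong[of f2, OF ext[OF f2_def]]
        cong[of f3, OF ext[OF f3_def]] cong[of f4, OF ext[OF f4_def]])
  moreover have "t mod p \<in> {0..<p}"
    using assms by (simp add: prime_gt_0_nat)
  ultimately have "{r \<in> {0..<p}. p dvd f1 r * f2 r * f3 r * f4 r} \<subset> {0..<p}"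
    by blast
  from psubset_card_mono[OF _ this] show ?thesis
    by (simp add: root_count_def)
qed

lemma card_roots_linear:
  fixes p a b :: nat
  assumes p: "prime p" and a: "\<not> p dvd a"
  shows "card {r \<in> {0..<p}. p dvd a * r + b} = 1"
proof -
  have cop: "coprime a p"
    using prime_imp_coprime[OF p a] by (simp add: coprime_commute)
  obtain x where x: "[a * x = 1] (mod p)"
    using cong_solve_coprime_nat[OF cop] by auto
  \<comment> \<open>This is -b/a modulo \<open>p\<close>, with \<open>p - 1\<close> standing for -1
    to stay within the naturals.\<close>
  define r where "r = (x * (p - 1) * b) mod p"
  have p1: "p \<ge> 1"
    using prime_gt_0_nat[OF p] by simp
  have "[a * r + b = a * (x * (p - 1) * b) + b] (mod p)"
    unfolding r_def cong_def by (metis mod_add_left_eq mod_mult_right_eq)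
  also have "a * (x * (p - 1) * b) + b = a * x * ((p - 1) * b) + b"
    by simp
  also have "[\<dots> = 1 * ((p - 1) * b) + b] (mod p)"
    by (intro cong_add cong_mult x) simp_all
  also have "1 * ((p - 1) * b) + b = p * b"
    using p1 by (simp add: algebra_simps)
  also have "[p * b = 0] (mod p)"
    by (simp add: cong_def)
  finally have r: "p dvd a * r + b"
    by (simp add: cong_0_iff)
  have "s = r" if "s < p" "p dvd a * s + b" for s
  proof -
    have "[a * s + b = a * r + b] (mod p)"
      using that r by (simp add: cong_def dvd_eq_mod_eq_0)
    then have "[s = r] (mod p)"
      using cop by (simp add: cong_add_rcancel_nat cong_mult_lcancel_nat)
    moreover have "r < p"
      using p1 by (simp add: r_def)
    ultimately show ?thesis
      using that by (simp add: cong_def)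
  qed
  moreover have "r < p"
    using p1 by (simp add: r_def)
  ultimately have "{s \<in> {0..<p}. p dvd a * s + b} = {r}"
    using r unfolding atLeastLessThan_iff by blast
  then show ?thesis
    by simp
qed

text \<open>Eliminating \<open>r\<close> leaves the resultant of the two forms, up to sign.\<close>

lemma linear_forms_common_root:
  fixes p a b c d r :: nat
  assumes "p dvd a * r + b" "p dvd c * r + d"
  shows "int p dvd int c * int b - int a * int d"
proof -
  have "int p dvd int c * int (a * r + b) - int a * int (c * r + d)"
    using assms by (intro dvd_diff dvd_mult) (simp_all only: int_dvd_int_iff)
  then show ?thesis
    by (simp add: algebra_simps)
qed

text \<open>Only 2, 3, 7 and 13 divide a leading coefficient or a pairwise resultant. For larger
  \<open>p\<close> each form has exactly one root, and no two forms share it.\<close>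

lemma root_count_eq_4:
  assumes p: "prime p" and large: "p > 13"
  shows "root_count p = 4"
proof -
  have not_dvd: "\<not> p dvd 2" "\<not> p dvd 3" "\<not> p dvd 7" "\<not> p dvd 13"
    using large by (auto dest!: dvd_imp_le)
  have nums: "(6::nat) = 2 * 3" "(36::nat) = 2 * 2 * 3 * 3" "(252::nat) = 2 * 2 * 3 * 3 * 7"
    "(78::nat) = 2 * 3 * 13" "(49::nat) = 7 * 7" "(216::nat) = 2 * 2 * 2 * 3 * 3 * 3"
    by simp_all
  \<comment> \<open>\<open>78\<close>, \<open>49\<close>, \<open>216\<close>, \<open>6\<close> are the nontrivial absolute resultants of pairs of the forms.\<close>
  have not_dvd': "\<not> p dvd 6" "\<not> p dvd 36" "\<not> p dvd 252" "\<not> p dvd 78" "\<not> p dvd 49"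
    "\<not> p dvd 216"
    unfolding nums using p not_dvd by (simp_all only: prime_dvd_mult_iff simp_thms)
  have int_dvd: "int p dvd numeral k \<longleftrightarrow> p dvd numeral k" for k
    by (metis int_dvd_int_iff of_nat_numeral)
  define A where "A f = {r \<in> {0..<p}. p dvd f r}" for f
  have fin: "finite (A f)" for f
    by (simp add: A_def)
  have card: "card (A f1) = 1" "card (A f2) = 1" "card (A f3) = 1" "card (A f4) = 1"
    unfolding A_def f_defs using p not_dvd not_dvd'
    by (simp_all only: card_roots_linear not_False_eq_True)
  have lam: "f1 = (\<lambda>t. 252 * t + 223)" "f2 = (\<lambda>t. 6 * t + 5)" "f3 = (\<lambda>t. 7 * t + 6)"
    "f4 = (\<lambda>t. 36 * t + 31)"
    by (simp_all add: fun_eq_iff f_defs)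
  have disjI: "A (\<lambda>t. a * t + b) \<inter> A (\<lambda>t. c * t + d) = {}"
    if "\<not> int p dvd int c * int b - int a * int d" for a b c d
    using that linear_forms_common_root unfolding A_def by blast
  have disj: "A f1 \<inter> A f2 = {}" "A f1 \<inter> A f3 = {}" "A f1 \<inter> A f4 = {}"
    "A f2 \<inter> A f3 = {}" "A f2 \<inter> A f4 = {}" "A f3 \<inter> A f4 = {}"
    unfolding lam using not_dvd' large by (intro disjI; simp add: int_dvd)+
  have "{r \<in> {0..<p}. p dvd f1 r * f2 r * f3 r * f4 r} = A f1 \<union> (A f2 \<union> (A f3 \<union> A f4))"
    using p by (auto simp: A_def prime_dvd_mult_iff)
  then have "root_count p = card (A f1 \<union> (A f2 \<union> (A f3 \<union> A f4)))"
    by (simp add: root_count_def)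
  also have "\<dots> = 4"
    using disj card fin by (simp add: card_Un_disjoint Int_Un_distrib)
  finally show ?thesis .
qed

section \<open>The singular series\<close>

lemma euler_factor_pos: "euler_factor n > 0"
proof (cases "prime n")
  case True
  then have "real n > 1" "real (root_count n) < real n"
    using root_count_less prime_gt_1_nat[of n] by auto
  then show ?thesis
    using True by (simp add: euler_factor_def singular_factor_def)
next
  case False
  then show ?thesis
    by (simp add: euler_factor_def)
qed

text \<open>With \<open>x = 1/p\<close> this bounds the deviation from 1 of an Euler factor having
  four roots: \<open>(1 - x) ^ 4\<close> and \<open>1 - 4 * x\<close> agree to first order.\<close>

lemma abs_euler_term_le:
  fixes x :: real
  assumes x: "0 \<le> x" "x \<le> 1/2"
  shows "\<bar>inverse ((1 - x) ^ 4) * (1 - 4 * x) - 1\<bar> \<le> 176 * x^2"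
proof -
  define q where "q = (1 - x) ^ 4"
  have "(1/2) ^ 4 \<le> q"
    unfolding q_def using x by (intro power_mono) linarith+
  then have q: "q \<ge> 1/16"
    by (simp add: eval_nat_numeral)
  have "1 - 4 * x - q = - (x^2 * (6 - 4 * x + x^2))"
    unfolding q_def by (simp add: eval_nat_numeral algebra_simps)
  moreover have "inverse q * (1 - 4 * x) - 1 = (1 - 4 * x - q) / q"
    using q by (simp add: field_simps)
  ultimately have "\<bar>inverse q * (1 - 4 * x) - 1\<bar> = x^2 * \<bar>6 - 4 * x + x^2\<bar> / q"
    using q by (simp add: abs_mult)
  \<comment> \<open>Crudely 6 + 4 + 1 = 11; dividing by \<open>q\<close>, which is at least 1/16,
    yields 176.\<close>
  also have "\<dots> \<le> x^2 * 11 / (1/16)"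
  proof (intro frac_le mult_left_mono)
    have "x^2 \<le> 1"
      using x by (intro power_le_one) linarith+
    then show "\<bar>6 - 4 * x + x^2\<bar> \<le> 11"
      using x zero_le_power2[of x] by linarith
  qed (use q in auto)
  finally show ?thesis
    by (simp add: q_def)
qed

lemma convergent_prod_euler_factor: "convergent_prod euler_factor"
proof -
  have bound: "norm \<bar>euler_factor n - 1\<bar> \<le> 176 * (1 / real n ^ 2)" if "n \<ge> 14" for n
  proof (cases "prime n")
    case True
    with that have "euler_factor n = inverse ((1 - 1 / real n) ^ 4) * (1 - 4 * (1 / real n))"
      by (simp add: euler_factor_def singular_factor_def root_count_eq_4)
    with abs_euler_term_le[of "1 / real n"] that show ?thesis
      by (simp add: power_divide)
  qed (simp add: euler_factor_def)
  have "summable (\<lambda>n. 176 * (1 / real n ^ 2))"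
    using inverse_power_summable[of 2, where 'a = real]
    by (intro summable_mult) (simp add: inverse_eq_divide)
  then have "summable (\<lambda>n. \<bar>euler_factor n - 1\<bar>)"
    using bound by (rule summable_comparison_test')
  \<comment> \<open>No factor vanishes; this also covers the small primes, outside the range of the
    estimate.\<close>
  moreover have "euler_factor n - 1 \<noteq> -1" for n
    using euler_factor_pos[of n] by simp
  ultimately have "convergent_prod (\<lambda>n. 1 + (euler_factor n - 1))"
    by (rule summable_imp_convergent_prod_real)
  then show ?thesis
    by simp
qed

text \<open>\<open>convergent_prod\<close> excludes the limit 0, so positive factors give a positive
  product.\<close>

lemma singular_series_pos: "singular_series > 0"
  unfolding singular_series_def
  by (intro less_0_prodinf convergent_prod_euler_factor euler_factor_pos)

section \<open>Hypothesis H\<close>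

lemma infinite_T_set:
  assumes "schinzel_H"
  shows "infinite T_set"
proof -
  define gs :: "int poly list" where "gs = [[:223, 252:], [:5, 6:], [:6, 7:], [:31, 36:]]"
  have poly: "(\<Prod>g\<leftarrow>gs. poly g (int t)) = int (f1 t * f2 t * f3 t * f4 t)" for t
    by (simp add: gs_def f_defs algebra_simps)
  \<comment> \<open>Irreducibility over the integers, not just the rationals, requires each linear
    polynomial to be primitive.\<close>
  have "coprime 223 (252::int)" "coprime 5 (6::int)" "coprime 6 (7::int)" "coprime 31 (36::int)"
    by code_simp+
  then have "\<forall>g\<in>set gs. degree g > 0 \<and> irreducible g \<and> lead_coeff g > 0"
    by (simp add: gs_def irreducible_linear_poly)
  moreover have "\<not> (\<exists>p::int. prime p \<and> (\<forall>t::int. p dvd (\<Prod>g\<leftarrow>gs. poly g t)))"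
  proof
    assume "\<exists>p::int. prime p \<and> (\<forall>t::int. p dvd (\<Prod>g\<leftarrow>gs. poly g t))"
    then obtain p :: int where p: "prime p" "\<And>t. p dvd (\<Prod>g\<leftarrow>gs. poly g t)"
      by blast
    from p(1) obtain q where q: "p = int q" "prime q"
      by (metis prime_ge_0_int nonneg_int_cases prime_nat_int_transfer)
    from q(2) obtain t where "\<not> q dvd f1 t * f2 t * f3 t * f4 t"
      by (rule no_fixed_prime_divisor)
    with p(2)[of "int t"] show False
      unfolding poly q(1) int_dvd_int_iff by simp
  qed
  moreover have "gs \<noteq> []"
    by (simp add: gs_def)
  ultimately have "infinite {t::nat. t \<ge> 1 \<and> (\<forall>g\<in>set gs. prime (poly g (int t)))}"
    using assms unfolding schinzel_H_def by blast
  moreover have "(\<forall>g\<in>set gs. prime (poly g (int t))) \<longleftrightarrow>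
      prime (f1 t) \<and> prime (f2 t) \<and> prime (f3 t) \<and> prime (f4 t)" for t
  proof -
    have "poly [:223, 252:] (int t) = int (f1 t)" "poly [:5, 6:] (int t) = int (f2 t)"
      "poly [:6, 7:] (int t) = int (f3 t)" "poly [:31, 36:] (int t) = int (f4 t)"
      by (simp_all add: f_defs)
    then show ?thesis
      unfolding gs_def by (simp only: list.set ball_simps prime_nat_int_transfer simp_thms)
  qed
  ultimately show ?thesis
    by (simp add: T_set_def)
qed

section \<open>Asymptotics\<close>

lemma log_integral_asymp_equiv:
  "(\<lambda>T::real. integral {2..T} (\<lambda>u. 1 / (ln u) ^ 4)) \<sim>[at_top] (\<lambda>T. T / (ln T) ^ 4)"
proof (rule asymp_equivI')
  \<comment> \<open>The derivative of \<open>T / ln T ^ 4\<close>; L'Hopital's quotient is then 1 /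
    (1 - 4 / ln x), which tends to 1.\<close>
  let ?g' = "\<lambda>x::real. 1 / ln x ^ 4 - 4 / ln x ^ 5"
  show "((\<lambda>T::real. integral {2..T} (\<lambda>u. 1 / (ln u) ^ 4) / (T / (ln T) ^ 4)) \<longlongrightarrow> 1) at_top"
  proof (rule lhospital_at_top_at_top[where f' = "\<lambda>x. 1 / ln x ^ 4" and g' = ?g'])
    show "filterlim (\<lambda>T::real. T / ln T ^ 4) at_top at_top"
      by real_asymp
    have "\<forall>\<^sub>F x in at_top. ?g' x > 0"
      by real_asymp
    then show "\<forall>\<^sub>F x in at_top. ?g' x \<noteq> 0"
      by eventually_elim simp
    show "((\<lambda>x. (1 / ln x ^ 4) / ?g' x) \<longlongrightarrow> 1) at_top"
      by real_asymp
    show "\<forall>\<^sub>F x in at_top. ((\<lambda>T. T / ln T ^ 4) has_real_derivative ?g' x) (at x)"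
      using eventually_gt_at_top[of 1]
    proof eventually_elim
      case (elim x)
      then have "ln x \<noteq> 0"
        by simp
      with elim show ?case
        by (auto intro!: derivative_eq_intros simp: divide_simps eval_nat_numeral)
           (simp add: algebra_simps)
    qed
    show "\<forall>\<^sub>F x in at_top.
        ((\<lambda>T. integral {2..T} (\<lambda>u. 1 / (ln u) ^ 4)) has_real_derivative 1 / ln x ^ 4) (at x)"
      using eventually_gt_at_top[of 2]
    proof eventually_elim
      case (elim x)
      \<comment> \<open>The interval reaches beyond \<open>x\<close>, making \<open>x\<close> an
        interior point, so the derivative within it is a full derivative.\<close>
      have "continuous_on {2..x + 1} (\<lambda>u::real. 1 / (ln u) ^ 4)"
        by (intro continuous_intros) auto
      from integral_has_real_derivative[OF this, of x] elim
      show ?case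
        by (simp add: at_within_Icc_at)
    qed
  qed
qed

text \<open>The larger root t of 1512 t^2 + 2598 t + 1115 = x, whose left side is
  \<open>n_of t\<close>; the square is completed after multiplying by 1512.\<close>

definition t_bound :: "real \<Rightarrow> real" where
  "t_bound x = (sqrt (1512 * x + 1521) - 1299) / 1512"

lemma n_of_le_iff: "real (n_of t) \<le> x \<longleftrightarrow> real t \<le> t_bound x"
proof -
  have "1512 * real (n_of t) + 1521 = (1512 * real t + 1299)\<^sup>2"
    by (simp add: n_of_def f_defs power2_eq_square algebra_simps)
  then have "real (n_of t) \<le> x \<longleftrightarrow> (1512 * real t + 1299)\<^sup>2 \<le> 1512 * x + 1521"
    by linarith
  also have "\<dots> \<longleftrightarrow> sqrt ((1512 * real t + 1299)\<^sup>2) \<le> sqrt (1512 * x + 1521)"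
    by (simp only: real_sqrt_le_iff)
  also have "\<dots> \<longleftrightarrow> real t \<le> t_bound x"
    by (auto simp: t_bound_def field_simps)
  finally show ?thesis .
qed

lemma F_count_asymp_equiv:
  assumes "bateman_horn_f1_f2_f3_f4"
  shows "(\<lambda>x::real. real (F_count x))
    \<sim>[at_top] (\<lambda>x. 8 * singular_series / (3 * sqrt 42) * (sqrt x / (ln x) ^ 4))"
proof -
  have lim: "filterlim t_bound at_top at_top"
    unfolding t_bound_def by real_asymp
  have "(\<lambda>T::real. real (card {t \<in> T_set. real t \<le> T}))
      \<sim>[at_top] (\<lambda>T. singular_series * (T / (ln T) ^ 4))"
    using assms unfolding bateman_horn_f1_f2_f3_f4_def
    by (rule asymp_equiv_trans) (intro asymp_equiv_intros log_integral_asymp_equiv)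
  from asymp_equiv_compose'[OF this lim]
  have "(\<lambda>x. real (F_count x)) \<sim>[at_top] (\<lambda>x. singular_series * (t_bound x / ln (t_bound x) ^ 4))"
    by (simp add: F_count_def n_of_le_iff)
  also have "(\<lambda>x. singular_series * (t_bound x / ln (t_bound x) ^ 4))
      \<sim>[at_top] (\<lambda>x. singular_series * (8 / (3 * sqrt 42) * (sqrt x / (ln x) ^ 4)))"
  proof (intro asymp_equiv_mult asymp_equiv_refl asymp_equivI'_const)
    \<comment> \<open>\<open>t_bound x\<close> grows like \<open>sqrt x / sqrt 1512\<close>, and its
      logarithm like half of \<open>ln x\<close>, whose fourth power puts 16 in the
      numerator.\<close>
    have "((\<lambda>x. (t_bound x / ln (t_bound x) ^ 4) / (sqrt x / ln x ^ 4))
        \<longlongrightarrow> 16 * sqrt 1512 / 1512) at_top"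
      unfolding t_bound_def by real_asymp (simp add: powr_half_sqrt power_divide)
    also have "16 * sqrt 1512 / 1512 = 8 / (3 * sqrt (42::real))"
      using real_sqrt_mult[of 36 42] real_sqrt_mult_self[of 42] by (simp add: field_simps)
    finally show "((\<lambda>x. (t_bound x / ln (t_bound x) ^ 4) / (sqrt x / ln x ^ 4))
        \<longlongrightarrow> 8 / (3 * sqrt 42)) at_top" .
  qed simp
  finally show ?thesis
    by (simp add: mult_ac)
qed

text \<open>Used to pass from the asymptotic formula to the lower bound. Positivity of
  \<open>g\<close> makes the plain quotient tend to 1, free of the 0/0 convention in asymptotic
  equivalence.\<close>

lemma asymp_equiv_imp_eventually_ge_half:
  fixes f g :: "'a \<Rightarrow> real"
  assumes "f \<sim>[F] g" "\<forall>\<^sub>F x in F. g x > 0"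
  shows "\<forall>\<^sub>F x in F. f x \<ge> g x / 2"
proof -
  have "((\<lambda>x. f x / g x) \<longlongrightarrow> 1) F"
    using assms by (intro asymp_equivD_strong) (auto elim: eventually_mono)
  then have "\<forall>\<^sub>F x in F. f x / g x > 1 / 2"
    by (rule order_tendstoD) simp
  with assms(2) show ?thesis
    by eventually_elim (simp add: field_simps)
qed

theorem theorem5p1:
  shows
    "(schinzel_H \<longrightarrow>
        infinite T_set \<and>
        (\<forall>t\<in>T_set. divisor_sum (N_of t) = 2 * divisor_sum (n_of t)) \<and>
        inj_on n_of T_set \<and>
        infinite {n::nat. n \<ge> 1 \<and> divisor_sum (n + 1) = 2 * divisor_sum n})
     \<and>
     (bateman_horn_f1_f2_f3_f4 \<longrightarrow>
        convergent_prod euler_factor \<and>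
        singular_series > 0 \<and>
        (\<lambda>x::real. real (F_count x))
          \<sim>[at_top] (\<lambda>x. 8 * singular_series / (3 * sqrt 42) * (sqrt x / (ln x) ^ 4)) \<and>
        (\<exists>c>0. \<forall>\<^sub>F x::real in at_top. real (F_count x) \<ge> c * (sqrt x / (ln x) ^ 4)))"
proof (intro conjI impI)
  assume H: "schinzel_H"
  have T: "t \<ge> 1" "divisor_sum (N_of t) = 2 * divisor_sum (n_of t)" if "t \<in> T_set" for t
    using that by (auto simp: T_set_def divisor_sum_n_of divisor_sum_N_of)
  show "infinite T_set"
    using H by (rule infinite_T_set)
  show "\<forall>t\<in>T_set. divisor_sum (N_of t) = 2 * divisor_sum (n_of t)"
    using T by blast
  show inj: "inj_on n_of T_set"
    using strict_mono_n_of by (simp add: strict_mono_imp_inj_on inj_on_subset)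
  \<comment> \<open>Injectivity turns infinitely many \<open>t\<close> into infinitely many
    solutions.\<close>
  have "infinite (n_of ` T_set)"
    using infinite_T_set[OF H] inj by (simp add: finite_image_iff)
  moreover have "n_of ` T_set \<subseteq> {n. n \<ge> 1 \<and> divisor_sum (n + 1) = 2 * divisor_sum n}"
    using T by (auto simp: N_of_def) (auto simp: n_of_def f_defs)
  ultimately show "infinite {n::nat. n \<ge> 1 \<and> divisor_sum (n + 1) = 2 * divisor_sum n}"
    using finite_subset by blast
next
  assume BH: "bateman_horn_f1_f2_f3_f4"
  show "convergent_prod euler_factor"
    by (rule convergent_prod_euler_factor)
  show "singular_series > 0"
    by (rule singular_series_pos)
  show equiv: "(\<lambda>x::real. real (F_count x))
      \<sim>[at_top] (\<lambda>x. 8 * singular_series / (3 * sqrt 42) * (sqrt x / (ln x) ^ 4))"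
    using BH by (rule F_count_asymp_equiv)
  define c where "c = 8 * singular_series / (3 * sqrt 42)"
  have c: "c > 0"
    using singular_series_pos by (simp add: c_def)
  have "\<forall>\<^sub>F x::real in at_top. sqrt x / (ln x) ^ 4 > 0"
    by real_asymp
  then have "\<forall>\<^sub>F x::real in at_top. c * (sqrt x / (ln x) ^ 4) > 0"
    by eventually_elim (rule mult_pos_pos[OF c])
  with equiv have "\<forall>\<^sub>F x in at_top. real (F_count x) \<ge> c * (sqrt x / (ln x) ^ 4) / 2"
    unfolding c_def by (intro asymp_equiv_imp_eventually_ge_half)
  then show "\<exists>c>0. \<forall>\<^sub>F x::real in at_top. real (F_count x) \<ge> c * (sqrt x / (ln x) ^ 4)"
    using c by (intro exI[of _ "c / 2"]) (simp add: mult_ac)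
qed

end
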